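(* (Spherical.) Given a triangle on the sphere of constant curvature $K=1$, let $R$ be its circumradius, $r$ its inradius, and $d$ the (geodesic) distance between its circumcenter and its incenter. Then $$\tan d=\begin{cases}\dfrac{\sqrt{\tan R\,(\tan R-2\tan r)}}{\sqrt{\tan^2 r+(1+\tan r\tan R)^2}}, & \text{if } R<\frac{\pi}{2},\\[2mm] 0, & \text{if } R=\frac{\pi}{2}.\end{cases}$$ (Hyperbolic.) Given a triangle in the hyperbolic plane of constant curvature $K=-1$ that has a circumscribed circle, let $R$ be its circumradius, $r$ its inradius, and $d$ the hyperbolic distance between its circumcenter and its incenter. Then $$\tanh d=\dfrac{\sqrt{\tanh R\,(\tanh R-2\tanh r)}}{\sqrt{-\tanh^2 r+(1-\tanh r\tanh R)^2}}.$$
   Context: Spherical geometry is the geometry of the unit sphere $S^2\subset\mathbb{R}^3$ (constant curvature $1$) with its geodesic distance; hyperbolic geometry is that of the hyperbolic plane of constant curvature $-1$ with its geodesic distance. The circumscribed circle of a triangle is the circle (set of points at a fixed geodesic distance, the circumradius $R$, from a point, the circumcenter) passing through the three vertices; the inscribed circle is the circle lying in the closed triangle and tangent to its three sides, with center the incenter and radius the inradius $r$. Spherical triangles: the three vertices are distinct and pairwise non-antipodal, the sides are the minimizing great circle arcs joining them (so of length less than $\pi$), and the circumcenter is chosen so that $R\le \pi/2$. If the vertices do not lie on one great circle, the triangle is the usual proper spherical triangle and $R<\pi/2$. The case $R=\pi/2$ is the degenerate one in which the three vertices lie on a great circle and the three sides together make up that great circle; the triangle is then a closed hemisphere bounded by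 it, and both the circumscribed and the inscribed circle coincide with that great circle, so that each of the circumcenter and the incenter is one of the two poles of that great circle. Three vertices on one great circle whose sides do not make up the whole great circle do not form a triangle. Hyperbolic triangles: the three vertices do not lie on one geodesic, and the sides are the geodesic segments joining them. A hyperbolic triangle need not have a circumscribed circle. *)

theory Defs
  imports "HOL-Analysis.Analysis"
begin

section \<open>Notions common to both geometries\<close>

text \<open>Both surfaces are realised in \<^typ>\<open>real^3\<close> as a component of a level set
  $\{x \mid B(x,x) = \pm 1\}$ of a bilinear form $B$: the sphere with the Euclidean inner product,
  the hyperbolic plane as the upper sheet of a two-sheeted hyperboloid with the Lorentz form.
  In both models the full geodesics are the nonempty sections by planes through the origin,
  and the geodesic circles are sections by affine planes $B(c,x) = const$.\<close>

text \<open>Points of the surface \<open>M\<close> in the cone over \<open>P\<close>.  For two points (non-antipodal on the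
  sphere) this is the minimizing geodesic segment joining them; for three points not on one
  geodesic it is the closed triangular region with these vertices.\<close>

definition geo_hull :: "(real^3) set \<Rightarrow> (real^3) set \<Rightarrow> (real^3) set" where
  "geo_hull M P = M \<inter> convex_cone hull P"

text \<open>Tangent spaces at \<open>p\<close>, as linear subspaces of \<^typ>\<open>real^3\<close>.  The circle with centre \<open>c\<close> is
  given by the equations $B(x,x) = const$, $B(c,x) = const$, and its tangent space is the common
  kernel of their differentials at \<open>p\<close>.  (This is a line unless the circle is a single point, in
  which case it is a plane and so never equals the tangent line of a geodesic.)  The geodesic
  through \<open>P\<close>, \<open>Q\<close> lies in \<^term>\<open>span {P, Q}\<close>.\<close>

definition circle_tangent_line ::
    "(real^3 \<Rightarrow> real^3 \<Rightarrow> real) \<Rightarrow> real^3 \<Rightarrow> real^3 \<Rightarrow> (real^3) set" where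
  "circle_tangent_line B c p = {v. B p v = 0 \<and> B c v = 0}"

definition geodesic_tangent_line ::
    "(real^3 \<Rightarrow> real^3 \<Rightarrow> real) \<Rightarrow> real^3 \<Rightarrow> real^3 \<Rightarrow> real^3 \<Rightarrow> (real^3) set" where
  "geodesic_tangent_line B P Q p = {v \<in> span {P, Q}. B p v = 0}"

text \<open>The circle \<open>K\<close> with centre \<open>c\<close> is tangent to the side \<open>PQ\<close>: they have a common point with a
  common tangent line.  A circle coinciding with the great circle carrying the side counts as
  tangent, as needed for degenerate spherical triangles.\<close>

definition tangent_to_side ::
    "(real^3) set \<Rightarrow> (real^3 \<Rightarrow> real^3 \<Rightarrow> real) \<Rightarrow> real^3 \<Rightarrow> (real^3) set \<Rightarrow> real^3 \<Rightarrow> real^3 \<Rightarrow> bool" where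
  "tangent_to_side M B c K P Q \<longleftrightarrow>
     (\<exists>p \<in> K \<inter> geo_hull M {P, Q}. circle_tangent_line B c p = geodesic_tangent_line B P Q p)"


section \<open>Spherical geometry\<close>

abbreviation S2 :: "(real^3) set" where
  "S2 \<equiv> sphere 0 1"

definition sdist :: "real^3 \<Rightarrow> real^3 \<Rightarrow> real" where
  "sdist x y = arccos (x \<bullet> y)"

definition scircle :: "real^3 \<Rightarrow> real \<Rightarrow> (real^3) set" where
  "scircle c \<rho> = {x \<in> S2. sdist c x = \<rho>}"

definition great_circle :: "real^3 \<Rightarrow> (real^3) set" where
  "great_circle n = {x \<in> S2. n \<bullet> x = 0}"

definition closed_hemisphere :: "real^3 \<Rightarrow> (real^3) set" where
  "closed_hemisphere n = {x \<in> S2. 0 \<le> n \<bullet> x}"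

text \<open>\<open>T\<close> is the closed triangle with vertices \<open>A\<close>, \<open>B\<close>, \<open>C\<close>.  In the degenerate case it may be
  either of the two hemispheres (\<open>n\<close> may be replaced by \<open>- n\<close>).\<close>

definition spherical_triangle ::
    "real^3 \<Rightarrow> real^3 \<Rightarrow> real^3 \<Rightarrow> (real^3) set \<Rightarrow> bool" where
  "spherical_triangle A B C T \<longleftrightarrow>
     A \<in> S2 \<and> B \<in> S2 \<and> C \<in> S2 \<and>
     A \<noteq> B \<and> B \<noteq> C \<and> C \<noteq> A \<and> A \<noteq> - B \<and> B \<noteq> - C \<and> C \<noteq> - A \<and>
     ((\<not> (\<exists>n \<in> S2. {A, B, C} \<subseteq> great_circle n) \<and> T = geo_hull S2 {A, B, C}) \<or>
      (\<exists>n \<in> S2. geo_hull S2 {A, B} \<union> geo_hull S2 {B, C} \<union> geo_hull S2 {C, A} = great_circle n \<and>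
               T = closed_hemisphere n))"

text \<open>A circle on the sphere has two (antipodal) centres, with radii \<open>\<rho>\<close> and \<open>pi - \<rho>\<close>; the bound
  \<open>pi / 2\<close> selects the one with the smaller radius, and admits both poles of a great circle.\<close>

definition spherical_circumscribed ::
    "real^3 \<Rightarrow> real^3 \<Rightarrow> real^3 \<Rightarrow> real^3 \<Rightarrow> real \<Rightarrow> bool" where
  "spherical_circumscribed A B C Z R \<longleftrightarrow>
     Z \<in> S2 \<and> R \<le> pi / 2 \<and> {A, B, C} \<subseteq> scircle Z R"

definition spherical_inscribed ::
    "real^3 \<Rightarrow> real^3 \<Rightarrow> real^3 \<Rightarrow> (real^3) set \<Rightarrow> real^3 \<Rightarrow> real \<Rightarrow> bool" where
  "spherical_inscribed A B C T I r \<longleftrightarrow>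
     I \<in> S2 \<and> 0 < r \<and> r \<le> pi / 2 \<and> scircle I r \<subseteq> T \<and>
     tangent_to_side S2 (\<bullet>) I (scircle I r) A B \<and>
     tangent_to_side S2 (\<bullet>) I (scircle I r) B C \<and>
     tangent_to_side S2 (\<bullet>) I (scircle I r) C A"


section \<open>Hyperbolic geometry (hyperboloid model)\<close>

definition lorentz :: "real^3 \<Rightarrow> real^3 \<Rightarrow> real" where
  "lorentz x y = x $ 1 * y $ 1 + x $ 2 * y $ 2 - x $ 3 * y $ 3"

definition H2 :: "(real^3) set" where
  "H2 = {x. lorentz x x = - 1 \<and> 0 < x $ 3}"

definition hdist :: "real^3 \<Rightarrow> real^3 \<Rightarrow> real" where
  "hdist x y = arcosh (- lorentz x y)"

definition hcircle :: "real^3 \<Rightarrow> real \<Rightarrow> (real^3) set" where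
  "hcircle c \<rho> = {x \<in> H2. hdist c x = \<rho>}"

text \<open>The planes through the origin that meet \<^const>\<open>H2\<close> are those with spacelike normal \<open>n\<close>.\<close>

definition hgeodesic :: "real^3 \<Rightarrow> (real^3) set" where
  "hgeodesic n = {x \<in> H2. lorentz n x = 0}"

definition hyperbolic_triangle :: "real^3 \<Rightarrow> real^3 \<Rightarrow> real^3 \<Rightarrow> bool" where
  "hyperbolic_triangle A B C \<longleftrightarrow>
     A \<in> H2 \<and> B \<in> H2 \<and> C \<in> H2 \<and> \<not> (\<exists>n. 0 < lorentz n n \<and> {A, B, C} \<subseteq> hgeodesic n)"

definition hyperbolic_circumscribed ::
    "real^3 \<Rightarrow> real^3 \<Rightarrow> real^3 \<Rightarrow> real^3 \<Rightarrow> real \<Rightarrow> bool" where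
  "hyperbolic_circumscribed A B C Z R \<longleftrightarrow> Z \<in> H2 \<and> {A, B, C} \<subseteq> hcircle Z R"

definition hyperbolic_inscribed ::
    "real^3 \<Rightarrow> real^3 \<Rightarrow> real^3 \<Rightarrow> real^3 \<Rightarrow> real \<Rightarrow> bool" where
  "hyperbolic_inscribed A B C I r \<longleftrightarrow>
     I \<in> H2 \<and> 0 < r \<and> hcircle I r \<subseteq> geo_hull H2 {A, B, C} \<and>
     tangent_to_side H2 lorentz I (hcircle I r) A B \<and>
     tangent_to_side H2 lorentz I (hcircle I r) B C \<and>
     tangent_to_side H2 lorentz I (hcircle I r) C A"

end

theory Submission
  imports Defs
begin

unbundle cross3_syntax

text \<open>
  The two geometries are two values of one parameter \<open>k = \<plusminus>1\<close>: both surfaces lie in the level set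
  \<open>form k x x = k\<close> of the form $x_1 y_1 + x_2 y_2 + k x_3 y_3$.  Points at distance \<open>t\<close> have
  \<open>form k x y = k * c\<close>, where \<open>(c, s)\<close> is \<open>(cos t, sin t)\<close> or \<open>(cosh t, sinh t)\<close>, so that
  $c^2 + k s^2 = 1$.  The formula for \<open>d\<close> is then equivalent, since \<open>k * form k Z I\<close> turns out to be
  positive, to the identity
  $(\mathit{form}\;k\;Z\;I)^2 = (c_R c_r + k s_R s_r)^2 + k (s_r c_R)^2$,
  which is \<open>center_distance\<close>; it is proved once, for both values of \<open>k\<close>.

  Its proof expresses both centres through the vertices.  The distance from \<open>I\<close> to the line of a
  side is governed by the form of \<open>I\<close> with the normal of that side.  If a circle about \<open>I\<close> touches the
  side at \<open>p\<close>, then \<open>I\<close>, \<open>p\<close> and the normal are linearly dependent, and the vanishing of their Gram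
  determinant gives this value up to sign (\<open>tangent_triple_product\<close>).  The sign is determined because
  the point of the circle opposite to \<open>p\<close> lies in the triangle (\<open>incenter_triple_product\<close>).  With
  \<open>D\<close> the determinant of the vertices, Cramer's rule now says
  $|D| I = s_r (a A + b B + h C)$, where \<open>a\<close>, \<open>b\<close>, \<open>h\<close> are the (hyperbolic) sines of the sides.
  Since all vertices have the same form with \<open>Z\<close>, this gives
  $|D|\,|\mathit{form}\;k\;Z\;I| = s_r c_R (a + b + h)$.

  In terms of the half sides, with sines \<open>x\<close>, \<open>y\<close>, \<open>z\<close>, and of the sine \<open>S\<close> of the semiperimeter, the
  two normalisations \<open>form k Z Z = k\<close> and \<open>form k I I = k\<close> become the classical formulas
  $\tan R = 4xyz/|D|$ and $\tan r = |D|/(2S)$ (or their analogues with tanh).  The identity for \<open>d\<close> is thereby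
  reduced to $(a+b+h)^2 = (2S + 4kxyz)^2 + kD^2$, a polynomial identity (\<open>half_side_identities\<close>).

  There remains the spherical triangle that is a hemisphere.  If its inscribed circle were smaller
  than the boundary great circle, it would touch that great circle in only one point, and this point
  would lie on all three sides, which have no common point (\<open>hemisphere_incenter\<close>).
\<close>


section \<open>The bilinear form and its normal vectors\<close>

definition form :: "real \<Rightarrow> real^3 \<Rightarrow> real^3 \<Rightarrow> real" where
  "form k x y = x $ 1 * y $ 1 + x $ 2 * y $ 2 + k * (x $ 3 * y $ 3)"

text \<open>The normal, with respect to \<open>form k\<close>, of the plane spanned by \<open>x\<close> and \<open>y\<close>: the cross product
  with its third coordinate rescaled, so that pairing with it by \<open>form k\<close> is the determinant.\<close>

definition conormal :: "real \<Rightarrow> real^3 \<Rightarrow> real^3 \<Rightarrow> real^3" where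
  "conormal k x y = vector [(x \<times> y) $ 1, (x \<times> y) $ 2, k * (x \<times> y) $ 3]"

lemma form_inner: "form 1 = (\<bullet>)"
  by (simp add: fun_eq_iff form_def inner_vec_def sum_3)

lemma form_lorentz: "form (- 1) = lorentz"
  by (simp add: fun_eq_iff form_def lorentz_def)

lemma triple_product:
  "x \<bullet> (y \<times> z) = x $ 1 * (y $ 2 * z $ 3 - y $ 3 * z $ 2) + x $ 2 * (y $ 3 * z $ 1 - y $ 1 * z $ 3)
     + x $ 3 * (y $ 1 * z $ 2 - y $ 2 * z $ 1)" for x y z :: "real^3"
  by (simp add: cross3_simps)

lemma conormal_nth [simp]:
  "conormal k x y $ 1 = x $ 2 * y $ 3 - x $ 3 * y $ 2"
  "conormal k x y $ 2 = x $ 3 * y $ 1 - x $ 1 * y $ 3"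
  "conormal k x y $ 3 = k * (x $ 1 * y $ 2 - x $ 2 * y $ 1)"
  by (simp_all add: conormal_def cross3_def)

lemma form_commute: "form k x y = form k y x"
  by (simp add: form_def algebra_simps)

lemma form_linear:
  "form k x (y + z) = form k x y + form k x z" "form k x (y - z) = form k x y - form k x z"
  "form k x (c *\<^sub>R y) = c * form k x y"
  "form k (y + z) x = form k y x + form k z x" "form k (y - z) x = form k y x - form k z x"
  "form k (c *\<^sub>R y) x = c * form k y x"
  by (simp_all add: form_def algebra_simps)

section \<open>Half sides and the semiperimeter\<close>

text \<open>Here \<open>x\<close>, \<open>y\<close>, \<open>z\<close> are the sines and \<open>X\<close>, \<open>Y\<close>, \<open>Z\<close> the cosines (hyperbolic ones for
  \<open>k = - 1\<close>) of the half sides, and \<open>S\<close> is the sine of the semiperimeter, by the addition theorem.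
  A side whose half has sine \<open>x\<close> has sine \<open>2 * x * X\<close>, and its end points have form \<open>k - 2 * x\<^sup>2\<close>, so the
  assumption on \<open>D\<close> is the Gram determinant of the vertices.  The second identity
  computes the square length of the combination of the vertices in which each is weighted by the sine
  of the opposite side; this vector points to the incenter.\<close>

lemma half_side_identities:
  fixes k x y z X Y Z :: real
  assumes k: "k * k = 1" and X: "X\<^sup>2 = 1 - k * x\<^sup>2" and Y: "Y\<^sup>2 = 1 - k * y\<^sup>2" and Z: "Z\<^sup>2 = 1 - k * z\<^sup>2"
    and D: "k * D\<^sup>2 = k * k * k + 2 * (k - 2 * x\<^sup>2) * (k - 2 * y\<^sup>2) * (k - 2 * z\<^sup>2) 
       - k * (k - 2 * x\<^sup>2)\<^sup>2 - k * (k - 2 * y\<^sup>2)\<^sup>2 - k * (k - 2 * z\<^sup>2)\<^sup>2"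
    and S: "S = x * Y * Z + X * y * Z + X * Y * z - k * x * y * z"
  shows "(2 * x * X + 2 * y * Y + 2 * z * Z)\<^sup>2 = (2 * S + 4 * k * x * y * z)\<^sup>2 + k * D\<^sup>2"
    and "k * ((2 * x * X)\<^sup>2 + (2 * y * Y)\<^sup>2 + (2 * z * Z)\<^sup>2) + 2 * (2 * x * X) * (2 * y * Y) * (k - 2 * z\<^sup>2)
       + 2 * (2 * y * Y) * (2 * z * Z) * (k - 2 * x\<^sup>2) + 2 * (2 * z * Z) * (2 * x * X) * (k - 2 * y\<^sup>2)
       = D\<^sup>2 + 4 * k * S\<^sup>2"
  using assms by algebra+

section \<open>Cones\<close>

lemma triple_product_side_sign:
  assumes "x \<in> convex_cone hull {A, B, C}"
  shows "0 \<le> (A \<bullet> (B \<times> C)) * (x \<bullet> (B \<times> C))"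
proof -
  define d where "d = A \<bullet> (B \<times> C)"
  have "{A, B, C} \<subseteq> {x. 0 \<le> (d *\<^sub>R (B \<times> C)) \<bullet> x}"
    using zero_le_square[of d]
    by (auto simp: d_def inner_commute dot_cross_self)
  then have "convex_cone hull {A, B, C} \<subseteq> {x. 0 \<le> (d *\<^sub>R (B \<times> C)) \<bullet> x}"
    by (rule hull_minimal) (rule convex_cone_halfspace_ge)
  with assms show ?thesis
    by (auto simp: d_def inner_commute)
qed

lemma triple_product_span:
  assumes "x \<in> convex_cone hull {P, Q}"
  shows "x \<bullet> (P \<times> Q) = 0"
proof -
  have "subspace {x. (P \<times> Q) \<bullet> x = 0}"
    by (rule subspace_hyperplane)
  then have "convex_cone hull {P, Q} \<subseteq> {x. (P \<times> Q) \<bullet> x = 0}"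
    by (intro hull_minimal subspace_imp_convex_cone) (auto simp: dot_cross_self)
  with assms show ?thesis
    by (auto simp: inner_commute)
qed

section \<open>Circumcenter and incenter in constant curvature\<close>

locale constant_curvature =
  fixes k :: real
  assumes k_cases: "k = 1 \<or> k = - 1"
begin

lemma k_square: "k * k = 1"
  using k_cases by auto

lemma form_conormal: "form k x (conormal k y z) = x \<bullet> (y \<times> z)"
  using k_cases by (auto simp: form_def triple_product)

lemma form_conormal_conormal:
  "form k (conormal k x y) (conormal k z w) = k * (form k x z * form k y w - form k x w * form k y z)"
  using k_cases by (auto simp: form_def algebra_simps)

lemma gram_determinant:
  "k * (x \<bullet> (y \<times> z))\<^sup>2 =
     form k x x * form k y y * form k z z + 2 * form k x y * form k y z * form k z x
     - form k x x * (form k y z)\<^sup>2 - form k y y * (form k z x)\<^sup>2 - form k z z * (form k x y)\<^sup>2"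
  unfolding triple_product form_def power2_eq_square by algebra

text \<open>Two expansions of a vector: \<open>cramer\<close> in terms of the vertices of a triangle serves for the
  incenter, given by its products with the normals of the sides; \<open>dual_cramer\<close> in terms of these
  normals serves for the circumcenter, given by its products with the vertices.\<close>

lemma cramer:
  "(x \<bullet> (y \<times> z)) *\<^sub>R w =
     (w \<bullet> (y \<times> z)) *\<^sub>R x + (w \<bullet> (z \<times> x)) *\<^sub>R y + (w \<bullet> (x \<times> y)) *\<^sub>R z"
  for x y z w :: "real^3"
  unfolding triple_product vec_eq_iff forall_3 vector_add_component vector_scaleR_component real_scaleR_def
  by (intro conjI; algebra)

lemma dual_cramer:
  "(x \<bullet> (y \<times> z)) *\<^sub>R w =
     form k w x *\<^sub>R conormal k y z + form k w y *\<^sub>R conormal k z x + form k w z *\<^sub>R conormal k x y"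
  using k_cases by (auto simp: vec_eq_iff forall_3 triple_product form_def algebra_simps)

text \<open>The vector \<open>v\<close> tangent at \<open>p\<close> to the geodesic \<open>PQ\<close> is tangent to the circle, hence orthogonal to \<open>I\<close>.
  As \<open>v\<close> is also orthogonal to \<open>p\<close> and to the normal \<open>m\<close> of \<open>PQ\<close>, the vectors \<open>I\<close>, \<open>p\<close>, \<open>m\<close> are
  dependent; their vanishing Gram determinant is the conclusion.  It says that the geodesic \<open>PQ\<close>
  is at distance \<open>r\<close> from \<open>I\<close>.\<close>

lemma tangent_triple_product:
  assumes tangent: "circle_tangent_line (form k) I p = geodesic_tangent_line (form k) P Q p"
    and p: "form k p p = k" and I: "form k I I = k" and pI: "form k I p = k * c"
    and cs: "c\<^sup>2 + k * s\<^sup>2 = 1" and coplanar: "p \<bullet> (P \<times> Q) = 0"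
  shows "(I \<bullet> (P \<times> Q))\<^sup>2 = s\<^sup>2 * form k (conormal k P Q) (conormal k P Q)"
proof -
  define m where "m = conormal k P Q"
  define v where "v = form k p Q *\<^sub>R P - form k p P *\<^sub>R Q"
  have "v \<in> span {P, Q}"
    unfolding v_def by (intro span_diff span_scale span_base) auto
  moreover have "form k p v = 0"
    by (simp add: v_def form_linear)
  ultimately have "v \<in> geodesic_tangent_line (form k) P Q p"
    by (simp add: geodesic_tangent_line_def)
  then have "form k I v = 0"
    unfolding tangent[symmetric] by (simp add: circle_tangent_line_def)
  moreover have "I \<bullet> (p \<times> m) = k * form k I v"
    using k_square unfolding m_def v_def triple_product form_def conormal_nth vector_minus_component 
      vector_scaleR_component real_scaleR_def by algebra
  ultimately have "I \<bullet> (p \<times> m) = 0"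
    by simp
  moreover have "form k p m = 0" "form k I m = I \<bullet> (P \<times> Q)"
    using coplanar by (simp_all add: m_def form_conormal)
  ultimately show ?thesis
    using gram_determinant[of I p m] p I pI cs k_square form_commute[of k m I] unfolding m_def[symmetric]
    by algebra
qed

lemma conormal_half_side:
  assumes "form k P P = k" "form k Q Q = k" "form k P Q = k - 2 * x\<^sup>2" "X\<^sup>2 = 1 - k * x\<^sup>2"
  shows "form k (conormal k P Q) (conormal k P Q) = (2 * x * X)\<^sup>2"
  unfolding form_conormal_conormal form_commute[of k Q P] assms(1-3) using assms(4) k_square by algebra

text \<open>The vector \<open>2 * c * I - p\<close> is the point of the circle opposite to \<open>p\<close>.  Since \<open>p\<close> is on the
  line \<open>PQ\<close>, this opposite point is on the same side of \<open>PQ\<close> as \<open>I\<close>; being in the triangle, it is on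
  the same side as \<open>W\<close>.  This selects the sign of the root of \<open>tangent_triple_product\<close>.  The
  conclusion is written without a quotient: after cancelling \<open>|D|\<close> with $D = W \bullet (P \times Q)$, its right-hand
  side is \<open>s * a\<close> with the sign of \<open>D\<close>.\<close>

lemma incenter_triple_product:
  assumes tangent: "tangent_to_side M (form k) I K P Q"
    and M: "\<And>v. v \<in> M \<Longrightarrow> form k v v = k"
    and I: "I \<in> M"
    and K: "K = {v \<in> M. form k I v = k * c}"
    and reflect: "\<And>p. p \<in> K \<Longrightarrow> (2 * c) *\<^sub>R I - p \<in> K"
    and inside: "K \<subseteq> convex_cone hull {W, P, Q}"
    and cs: "c\<^sup>2 + k * s\<^sup>2 = 1" "0 < c" "0 < s"
    and a: "form k (conormal k P Q) (conormal k P Q) = a\<^sup>2" "0 \<le> a"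
  shows "\<bar>W \<bullet> (P \<times> Q)\<bar> * (I \<bullet> (P \<times> Q)) = (W \<bullet> (P \<times> Q)) * (s * a)"
proof -
  obtain p where p: "p \<in> K" "p \<in> geo_hull M {P, Q}"
    and line: "circle_tangent_line (form k) I p = geodesic_tangent_line (form k) P Q p"
    using tangent unfolding tangent_to_side_def by auto
  have p0: "p \<bullet> (P \<times> Q) = 0"
    using p(2) triple_product_span unfolding geo_hull_def by auto
  have "(I \<bullet> (P \<times> Q))\<^sup>2 = s\<^sup>2 * a\<^sup>2"
    using tangent_triple_product[OF line _ _ _ cs(1) p0] p(1) M I K a(1) by auto
  then have "\<bar>I \<bullet> (P \<times> Q)\<bar> = s * a"
    using cs a(2) by (metis abs_of_nonneg mult_nonneg_nonneg less_imp_le power2_eq_iff_nonneg abs_ge_zero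
        power2_abs power_mult_distrib)
  moreover have "0 \<le> (W \<bullet> (P \<times> Q)) * (((2 * c) *\<^sub>R I - p) \<bullet> (P \<times> Q))"
    using triple_product_side_sign reflect[OF p(1)] inside by blast
  then have "0 \<le> 2 * c * ((W \<bullet> (P \<times> Q)) * (I \<bullet> (P \<times> Q)))"
    using p0 by (simp add: inner_diff_left algebra_simps)
  then have "0 \<le> (W \<bullet> (P \<times> Q)) * (I \<bullet> (P \<times> Q))"
    using cs by (simp add: zero_le_mult_iff)
  then have "\<bar>W \<bullet> (P \<times> Q)\<bar> * (I \<bullet> (P \<times> Q)) = (W \<bullet> (P \<times> Q)) * \<bar>I \<bullet> (P \<times> Q)\<bar>"
    by (auto simp: abs_if zero_le_mult_iff)
  ultimately show ?thesis
    by simp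
qed

text \<open>The circumcenter is proportional to the sum \<open>N\<close> of the normals of the three sides, and \<open>Z\<close> having
  form \<open>k\<close> with itself determines the factor.  The result is $\tan R = 4xyz/|D|$, squared.\<close>

lemma circumradius_half_sides:
  assumes A: "form k A A = k" and B: "form k B B = k" and C: "form k C C = k" and Z: "form k Z Z = k"
    and ZA: "form k Z A = k * cR" and ZB: "form k Z B = k * cR" and ZC: "form k Z C = k * cR"
    and csR: "cR\<^sup>2 + k * sR\<^sup>2 = 1"
    and x: "form k B C = k - 2 * x\<^sup>2" and y: "form k C A = k - 2 * y\<^sup>2" and z: "form k A B = k - 2 * z\<^sup>2"
  shows "((A \<bullet> (B \<times> C)) * sR)\<^sup>2 = (4 * x * y * z * cR)\<^sup>2"
proof -
  define D where "D = A \<bullet> (B \<times> C)"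
  define u where "u = form k B C"
  define v where "v = form k C A"
  define w where "w = form k A B"
  define N where "N = conormal k B C + conormal k C A + conormal k A B"
  have comm: "form k C B = u" "form k A C = v" "form k B A = w"
    unfolding u_def v_def w_def by (rule form_commute)+
  have "D *\<^sub>R Z = (k * cR) *\<^sub>R N"
    unfolding D_def dual_cramer[of A B C Z] ZA ZB ZC N_def by (simp add: scaleR_add_right)
  then have "form k (D *\<^sub>R Z) (D *\<^sub>R Z) = form k ((k * cR) *\<^sub>R N) ((k * cR) *\<^sub>R N)"
    by (rule arg_cong2[where f = "form k"]) fact
  then have 1: "D * (D * k) = k * cR * (k * cR * form k N N)"
    unfolding form_linear Z .
  have 2: "form k N N = k * (k\<^sup>2 - u\<^sup>2 + (k\<^sup>2 - v\<^sup>2) + (k\<^sup>2 - w\<^sup>2)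
      + 2 * (u * v - k * w) + 2 * (v * w - k * u) + 2 * (w * u - k * v))"
    unfolding N_def form_linear form_conormal_conormal A B C comm u_def[symmetric] v_def[symmetric] w_def[symmetric]
    by (simp add: algebra_simps power2_eq_square)
  have 3: "k * D\<^sup>2 = k * k * k + 2 * w * u * v - k * u\<^sup>2 - k * v\<^sup>2 - k * w\<^sup>2"
    unfolding D_def u_def v_def w_def using gram_determinant[of A B C] A B C by simp
  have xyz: "2 * x\<^sup>2 = k - u" "2 * y\<^sup>2 = k - v" "2 * z\<^sup>2 = k - w"
    by (simp_all add: u_def v_def w_def x y z)
  have "(2 * x\<^sup>2) * (2 * y\<^sup>2) * (2 * z\<^sup>2) = (k - u) * (k - v) * (k - w)"
    unfolding xyz ..
  then have "k * form k N N = D\<^sup>2 + 16 * k * (x * y * z)\<^sup>2"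
    using 2 3 k_square by algebra
  moreover have "D\<^sup>2 = cR\<^sup>2 * (k * form k N N)"
    using 1 k_square by algebra
  ultimately have "D\<^sup>2 = cR\<^sup>2 * (D\<^sup>2 + 16 * k * (x * y * z)\<^sup>2)"
    by simp
  then show ?thesis
    using csR k_square unfolding D_def[symmetric] by algebra
qed

text \<open>Both geometries enter through \<open>M\<close>, which is the sphere or the hyperbolic plane; closure of the
  circle under passing to opposite points and positivity of the sine of the semiperimeter have
  different reasons in the two cases and are therefore assumed.\<close>

theorem center_distance:
  assumes M: "\<And>v. v \<in> M \<Longrightarrow> form k v v = k"
    and vertices: "A \<in> M" "B \<in> M" "C \<in> M" and centres: "Z \<in> M" "I \<in> M"
    and D: "A \<bullet> (B \<times> C) \<noteq> 0"
    and x: "form k B C = k - 2 * x\<^sup>2" "X\<^sup>2 = 1 - k * x\<^sup>2" "0 \<le> x" "0 \<le> X"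
    and y: "form k C A = k - 2 * y\<^sup>2" "Y\<^sup>2 = 1 - k * y\<^sup>2" "0 \<le> y" "0 \<le> Y"
    and z: "form k A B = k - 2 * z\<^sup>2" "W\<^sup>2 = 1 - k * z\<^sup>2" "0 \<le> z" "0 \<le> W"
    and S_pos: "0 < x * Y * W + X * y * W + X * Y * z - k * x * y * z"
    and circum: "form k Z A = k * cR" "form k Z B = k * cR" "form k Z C = k * cR"
    and csR: "cR\<^sup>2 + k * sR\<^sup>2 = 1" "0 \<le> cR" "0 \<le> sR"
    and K: "K = {v \<in> M. form k I v = k * c}"
    and reflect: "\<And>p. p \<in> K \<Longrightarrow> (2 * c) *\<^sub>R I - p \<in> K"
    and cs: "c\<^sup>2 + k * s\<^sup>2 = 1" "0 < c" "0 < s"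
    and inside: "K \<subseteq> convex_cone hull {A, B, C}"
    and tangent: "tangent_to_side M (form k) I K A B" "tangent_to_side M (form k) I K B C"
      "tangent_to_side M (form k) I K C A"
  shows "(form k Z I)\<^sup>2 = (cR * c + k * (sR * s))\<^sup>2 + k * (s * cR)\<^sup>2"
proof -
  define D where "D = A \<bullet> (B \<times> C)"
  define S where "S = x * Y * W + X * y * W + X * Y * z - k * x * y * z"
  define a where "a = 2 * x * X"
  define b where "b = 2 * y * Y"
  define h where "h = 2 * z * W"
  note unit = vertices[THEN M] centres[THEN M]
  have D_cyc: "B \<bullet> (C \<times> A) = D" "C \<bullet> (A \<times> B) = D"
    by (simp_all add: D_def triple_product algebra_simps)
  have "D \<noteq> 0"
    using D by (simp add: D_def)
  note side = incenter_triple_product[OF _ M \<open>I \<in> M\<close> K reflect _ cs]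
  have Ia: "\<bar>D\<bar> * (I \<bullet> (B \<times> C)) = D * (s * a)"
    unfolding D_def by (rule side[OF tangent(2)])
      (use inside x in \<open>auto simp: a_def conormal_half_side unit\<close>)
  have Ib: "\<bar>D\<bar> * (I \<bullet> (C \<times> A)) = D * (s * b)"
    unfolding D_cyc(1)[symmetric] by (rule side[OF tangent(3)])
      (use inside y in \<open>auto simp: b_def conormal_half_side unit insert_commute\<close>)
  have Ih: "\<bar>D\<bar> * (I \<bullet> (A \<times> B)) = D * (s * h)"
    unfolding D_cyc(2)[symmetric] by (rule side[OF tangent(1)])
      (use inside z in \<open>auto simp: h_def conormal_half_side unit insert_commute\<close>)
  have "D *\<^sub>R (\<bar>D\<bar> *\<^sub>R I) = \<bar>D\<bar> *\<^sub>R (D *\<^sub>R I)"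
    by (simp add: mult.commute)
  also have "\<dots> = D *\<^sub>R (s *\<^sub>R (a *\<^sub>R A + b *\<^sub>R B + h *\<^sub>R C))"
    using Ia Ib Ih
    by (simp add: D_def[symmetric] cramer[of A B C I, folded D_def] scaleR_add_right)
  finally have I_eq: "\<bar>D\<bar> *\<^sub>R I = s *\<^sub>R (a *\<^sub>R A + b *\<^sub>R B + h *\<^sub>R C)"
    by (rule scaleR_left_imp_eq[OF \<open>D \<noteq> 0\<close>])
  have gram: "k * D\<^sup>2 = k * k * k + 2 * (k - 2 * x\<^sup>2) * (k - 2 * y\<^sup>2) * (k - 2 * z\<^sup>2)
       - k * (k - 2 * x\<^sup>2)\<^sup>2 - k * (k - 2 * y\<^sup>2)\<^sup>2 - k * (k - 2 * z\<^sup>2)\<^sup>2"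
    unfolding D_def gram_determinant[of A B C] unit x(1) y(1) z(1) by (simp add: algebra_simps)
  note identities = half_side_identities[OF k_square x(2) y(2) z(2) gram S_def]
  have "form k (\<bar>D\<bar> *\<^sub>R I) (\<bar>D\<bar> *\<^sub>R I) = 
      s * (s * (k * (a\<^sup>2 + b\<^sup>2 + h\<^sup>2) + 2 * a * b * (k - 2 * z\<^sup>2) + 2 * b * h * (k - 2 * x\<^sup>2)
        + 2 * h * a * (k - 2 * y\<^sup>2)))"
    unfolding I_eq form_linear unit x(1) y(1) z(1) form_commute[of k B A] form_commute[of k C B] form_commute[of k A C]
    by (simp add: algebra_simps power2_eq_square)
  \<comment> \<open>The vector on the right of \<open>I_eq\<close> has known length, which gives the inradius.\<close>
  then have "D\<^sup>2 * k = s\<^sup>2 * (D\<^sup>2 + 4 * k * S\<^sup>2)"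
    using identities(2) unfolding form_linear unit a_def b_def h_def by (simp add: power2_eq_square)
  then have "(2 * S * s)\<^sup>2 = (\<bar>D\<bar> * c)\<^sup>2"
    using cs(1) k_square power2_abs[of D] by algebra
  then have r: "2 * S * s = \<bar>D\<bar> * c"
    by (rule power2_eq_imp_eq) (use S_pos cs in \<open>auto simp: S_def[symmetric]\<close>)
  have "(\<bar>D\<bar> * sR)\<^sup>2 = (4 * x * y * z * cR)\<^sup>2"
    using circumradius_half_sides[OF unit(1-4) circum csR(1) x(1) y(1) z(1)]
    by (simp add: D_def power_mult_distrib)
  then have R: "\<bar>D\<bar> * sR = 4 * x * y * z * cR"
    by (rule power2_eq_imp_eq) (use csR x y z in auto)
  have "\<bar>D\<bar> * form k Z I = form k Z (\<bar>D\<bar> *\<^sub>R I)"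
    by (simp add: form_linear)
  also have "\<dots> = s * (k * cR) * (a + b + h)"
    unfolding I_eq form_linear circum by (simp add: algebra_simps)
  finally have "\<bar>D\<bar> * form k Z I = s * (k * cR) * (a + b + h)" .
  then have "D\<^sup>2 * (form k Z I)\<^sup>2 = D\<^sup>2 * ((cR * c + k * (sR * s))\<^sup>2 + k * (s * cR)\<^sup>2)"
    using identities(1) r R k_square power2_abs[of D] unfolding a_def b_def h_def by algebra
  then show ?thesis
    using \<open>D \<noteq> 0\<close> by simp
qed

text \<open>The witnesses are the half-angle formulas.\<close>

lemma half_side_exists:
  assumes "0 < k - form k P Q" "0 < 1 + k * form k P Q"
  obtains x X where "form k P Q = k - 2 * x\<^sup>2" "X\<^sup>2 = 1 - k * x\<^sup>2" "0 < x" "0 < X"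
proof
  show "form k P Q = k - 2 * (sqrt ((k - form k P Q) / 2))\<^sup>2"
    using assms by (simp add: field_simps)
  show "(sqrt ((1 + k * form k P Q) / 2))\<^sup>2 = 1 - k * (sqrt ((k - form k P Q) / 2))\<^sup>2"
    using assms k_square by (simp add: field_simps)
qed (use assms in auto)

end

section \<open>From the square of the form to the tangent of the distance\<close>

text \<open>Dividing the identity of \<open>center_distance\<close> by \<open>q\<^sup>2\<close>, where \<open>q = cos R * cos r\<close>, makes its
  right-hand side the denominator of the formula; subtracting the identity from \<open>1\<close> before dividing
  gives the numerator.  Positivity of \<open>u\<close> fixes the sign of the root.\<close>

lemma tan_arccos_euler:
  assumes u: "u\<^sup>2 = (cos R * cos r + sin R * sin r)\<^sup>2 + (sin r * cos R)\<^sup>2" and "0 < u"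
    and "0 < cos R" "0 < cos r" "\<bar>u\<bar> \<le> 1"
  shows "tan (arccos u) =
     sqrt (tan R * (tan R - 2 * tan r)) / sqrt ((tan r)\<^sup>2 + (1 + tan r * tan R)\<^sup>2)"
proof -
  define q where "q = cos R * cos r"
  have "0 < q"
    using assms by (simp add: q_def)
  have "(tan r)\<^sup>2 + (1 + tan r * tan R)\<^sup>2 = (u / q)\<^sup>2"
    unfolding power_divide u q_def tan_def using assms(3,4) by (simp add: field_simps power2_eq_square)
  moreover have "tan R * (tan R - 2 * tan r) = (1 - u\<^sup>2) / q\<^sup>2"
  proof -
    have diff: "1 - u\<^sup>2 = sin R * cos r * (sin R * cos r - 2 * (sin r * cos R))"
      unfolding u using sin_cos_squared_add[of R] sin_cos_squared_add[of r] by algebra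
    show ?thesis
      unfolding diff q_def tan_def using assms(3,4) by (simp add: field_simps power2_eq_square)
  qed
  moreover have "tan (arccos u) = sqrt (1 - u\<^sup>2) / u"
    using assms(5) by (simp add: tan_def sin_arccos_abs cos_arccos_abs)
  ultimately show ?thesis
    using \<open>0 < u\<close> \<open>0 < q\<close> by (simp add: real_sqrt_divide)
qed

lemma tanh_arcosh_euler:
  fixes u R r :: real
  assumes u: "u\<^sup>2 = (cosh R * cosh r - sinh R * sinh r)\<^sup>2 - (sinh r * cosh R)\<^sup>2" and "1 \<le> u"
  shows "tanh (arcosh u) =
     sqrt (tanh R * (tanh R - 2 * tanh r)) / sqrt (- (tanh r)\<^sup>2 + (1 - tanh r * tanh R)\<^sup>2)"
proof -
  define q where "q = cosh R * cosh r"
  have "0 < q"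
    by (simp add: q_def)
  have "- (tanh r)\<^sup>2 + (1 - tanh r * tanh R)\<^sup>2 = (u / q)\<^sup>2"
    unfolding power_divide u q_def tanh_def by (simp add: field_simps power2_eq_square)
  moreover have "tanh R * (tanh R - 2 * tanh r) = (u\<^sup>2 - 1) / q\<^sup>2"
  proof -
    have diff: "u\<^sup>2 - 1 = sinh R * cosh r * (sinh R * cosh r - 2 * (sinh r * cosh R))"
      unfolding u using hyperbolic_pythagoras[of R] hyperbolic_pythagoras[of r] by algebra
    show ?thesis
      unfolding diff q_def tanh_def by (simp add: field_simps power2_eq_square)
  qed
  moreover have "tanh (arcosh u) = sqrt (u\<^sup>2 - 1) / u"
    using assms(2) by (simp add: tanh_def sinh_arcosh_real)
  ultimately show ?thesis
    using \<open>1 \<le> u\<close> \<open>0 < q\<close> by (simp add: real_sqrt_divide)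
qed

section \<open>Points and circles on the sphere\<close>

interpretation spherical: constant_curvature 1
  by unfold_locales simp

lemma inner_unit: "v \<in> S2 \<Longrightarrow> v \<bullet> v = 1"
  by (simp add: dot_square_norm)

lemma abs_inner_less_1:
  assumes "P \<in> S2" "Q \<in> S2" "P \<noteq> Q" "P \<noteq> - Q"
  shows "\<bar>P \<bullet> Q\<bar> < 1"
proof -
  have "0 < (P - Q) \<bullet> (P - Q)" "0 < (P + Q) \<bullet> (P + Q)"
    using assms by (simp_all add: inner_gt_zero_iff eq_neg_iff_add_eq_0)
  then show ?thesis
    using inner_unit[OF assms(1)] inner_unit[OF assms(2)]
    by (simp add: inner_diff_left inner_diff_right inner_add_left inner_add_right inner_commute)
qed

lemma scircle_eq:
  assumes "c \<in> S2" "0 \<le> \<rho>" "\<rho> \<le> pi"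
  shows "scircle c \<rho> = {x \<in> S2. c \<bullet> x = cos \<rho>}"
proof -
  have "sdist c x = \<rho> \<longleftrightarrow> c \<bullet> x = cos \<rho>" if "x \<in> S2" for x
  proof -
    have "\<bar>c \<bullet> x\<bar> \<le> 1"
      using Cauchy_Schwarz_ineq2[of c x] assms(1) that by simp
    then show ?thesis
      unfolding sdist_def using assms by (auto simp: cos_arccos_abs arccos_cos)
  qed
  then show ?thesis
    unfolding scircle_def by blast
qed

lemma spherical_reflection:
  assumes "I \<in> S2" "p \<in> S2" "I \<bullet> p = c"
  shows "(2 * c) *\<^sub>R I - p \<in> S2" "I \<bullet> ((2 * c) *\<^sub>R I - p) = c"
proof -
  show "I \<bullet> ((2 * c) *\<^sub>R I - p) = c"
    using assms inner_unit by (simp add: inner_diff_right)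
  have "((2 * c) *\<^sub>R I - p) \<bullet> ((2 * c) *\<^sub>R I - p) = 1"
    using assms inner_unit[of I] inner_unit[of p]
    by (simp add: inner_diff_right inner_diff_left inner_commute[of p I])
  then show "(2 * c) *\<^sub>R I - p \<in> S2"
    by (simp add: norm_eq_1)
qed

lemma cross_nonzero:
  assumes "P \<in> S2" "Q \<in> S2" "P \<noteq> Q" "P \<noteq> - Q"
  shows "P \<times> Q \<noteq> 0"
proof -
  have "(norm (P \<times> Q))\<^sup>2 + (P \<bullet> Q)\<^sup>2 = 1"
    using norm_cross_dot[of P Q] assms by simp
  moreover have "(P \<bullet> Q)\<^sup>2 < 1"
    using abs_inner_less_1[OF assms] by (simp add: abs_square_less_1)
  ultimately show ?thesis
    by auto
qed

lemma spherical_circumscribed_inner: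
  assumes S: "A \<in> S2" "B \<in> S2" "C \<in> S2" and circum: "spherical_circumscribed A B C Z R"
  shows "0 \<le> R" "R \<le> pi / 2" "Z \<bullet> A = cos R" "Z \<bullet> B = cos R" "Z \<bullet> C = cos R"
proof -
  have Z: "Z \<in> S2" and "sdist Z A = R" and R: "R \<le> pi / 2"
    using circum by (auto simp: spherical_circumscribed_def scircle_def)
  moreover have "\<bar>Z \<bullet> A\<bar> \<le> 1"
    using Cauchy_Schwarz_ineq2[of Z A] Z S by simp
  ultimately show "0 \<le> R" "R \<le> pi / 2"
    unfolding sdist_def by (auto simp: abs_le_iff intro: arccos_lbound)
  then show "Z \<bullet> A = cos R" "Z \<bullet> B = cos R" "Z \<bullet> C = cos R"
    using circum Z unfolding spherical_circumscribed_def by (auto simp: scircle_eq)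
qed

lemma great_circle_coplanar:
  assumes "A \<in> S2" "B \<in> S2" "C \<in> S2" "A \<noteq> B" "A \<noteq> - B" "A \<bullet> (B \<times> C) = 0"
  shows "\<exists>n \<in> S2. {A, B, C} \<subseteq> great_circle n"
proof -
  have "A \<times> B \<noteq> 0"
    by (rule cross_nonzero) (fact assms)+
  moreover have "(A \<times> B) \<bullet> A = 0" "(A \<times> B) \<bullet> B = 0" "(A \<times> B) \<bullet> C = 0"
    using assms(6) by (simp_all add: dot_cross_self triple_product inner_commute[of "A \<times> B" C] algebra_simps)
  ultimately show ?thesis
    using assms(1-3) by (intro bexI[of _ "(1 / norm (A \<times> B)) *\<^sub>R (A \<times> B)"]) (auto simp: great_circle_def)
qed

text \<open>The perimeter of a proper spherical triangle is less than that of a great circle.  Heron's formula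
  $D^2 = 4 \sin\sigma \sin(\sigma-a) \sin(\sigma-b) \sin(\sigma-c)$, with \<open>\<sigma>\<close> the semiperimeter, has four factors
  any two of which have a positive sum, so at most one is nonpositive; as the product is positive,
  none is.\<close>

lemma sin_semiperimeter_pos:
  fixes x y z X Y W :: real
  assumes "0 < x" "0 < y" "0 < z" "0 < X" "0 < Y" "0 < W"
    and X: "X\<^sup>2 = 1 - x\<^sup>2" and Y: "Y\<^sup>2 = 1 - y\<^sup>2" and W: "W\<^sup>2 = 1 - z\<^sup>2"
    and D: "D\<^sup>2 = 1 + 2 * (1 - 2 * x\<^sup>2) * (1 - 2 * y\<^sup>2) * (1 - 2 * z\<^sup>2)
       - (1 - 2 * x\<^sup>2)\<^sup>2 - (1 - 2 * y\<^sup>2)\<^sup>2 - (1 - 2 * z\<^sup>2)\<^sup>2" and "D \<noteq> 0"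
  shows "0 < x * Y * W + X * y * W + X * Y * z - x * y * z"
proof -
  define S where "S = x * Y * W + X * y * W + X * Y * z - x * y * z"
  define S1 where "S1 = - x * Y * W + X * y * W + X * Y * z + x * y * z"
  define S2 where "S2 = x * Y * W - X * y * W + X * Y * z + x * y * z"
  define S3 where "S3 = x * Y * W + X * y * W - X * Y * z + x * y * z"
  have prod: "D\<^sup>2 = 4 * (S * S1 * (S2 * S3))"
    using X Y W D unfolding S_def S1_def S2_def S3_def by algebra
  have sums: "0 < S + S1" "0 < S + S2" "0 < S + S3" "0 < S1 + S2" "0 < S1 + S3" "0 < S2 + S3"
    using assms(1-6) unfolding S_def S1_def S2_def S3_def by (simp_all add: add_pos_pos)
  show ?thesis
  proof (rule ccontr)
    assume "\<not> ?thesis"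
    then have "S \<le> 0"
      by (simp add: S_def)
    then have "0 < S1" "0 < S2" "0 < S3"
      using sums by linarith+
    then have "S * S1 * (S2 * S3) \<le> 0"
      using \<open>S \<le> 0\<close> by (simp add: mult_nonpos_nonneg)
    then show False
      using prod \<open>D \<noteq> 0\<close> by (metis linorder_not_less mult_nonneg_nonpos zero_le_numeral zero_less_power2)
  qed
qed

lemma hull_half_space_pos:
  assumes "x \<in> convex_cone hull P" "x \<noteq> 0" "\<And>v. v \<in> P \<Longrightarrow> 0 < Z \<bullet> v"
  shows "0 < Z \<bullet> x"
proof -
  have "convex_cone ({0} \<union> {x. 0 < Z \<bullet> x})"
    by (auto simp: convex_cone_iff inner_simps add_pos_pos) 
  then have "convex_cone hull P \<subseteq> {0} \<union> {x. 0 < Z \<bullet> x}"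
    using assms(3) by (intro hull_minimal) auto
  then show ?thesis
    using assms(1,2) by auto
qed

section \<open>Points and circles in the hyperbolic plane\<close>

interpretation hyperbolic: constant_curvature "- 1"
  by unfold_locales simp

text \<open>The reverse Cauchy-Schwarz inequality; its defect is the sum of squares in the proof.\<close>

lemma lorentz_less_minus_1:
  assumes "P \<in> H2" "Q \<in> H2" "P \<noteq> Q"
  shows "lorentz P Q < - 1"
proof (rule ccontr)
  assume "\<not> ?thesis"
  then have *: "P $ 3 * Q $ 3 \<le> 1 + (P $ 1 * Q $ 1 + P $ 2 * Q $ 2)"
    by (simp add: lorentz_def)
  have P: "(P $ 3)\<^sup>2 = 1 + (P $ 1)\<^sup>2 + (P $ 2)\<^sup>2" "0 < P $ 3"
    and Q: "(Q $ 3)\<^sup>2 = 1 + (Q $ 1)\<^sup>2 + (Q $ 2)\<^sup>2" "0 < Q $ 3"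
    using assms(1,2) by (auto simp: H2_def lorentz_def power2_eq_square)
  have "(P $ 3 * Q $ 3)\<^sup>2 \<le> (1 + (P $ 1 * Q $ 1 + P $ 2 * Q $ 2))\<^sup>2"
    using * P Q by (intro power_mono) auto
  moreover have "(P $ 3 * Q $ 3)\<^sup>2 = (1 + (P $ 1 * Q $ 1 + P $ 2 * Q $ 2))\<^sup>2
      + ((P $ 1 - Q $ 1)\<^sup>2 + (P $ 2 - Q $ 2)\<^sup>2 + (P $ 1 * Q $ 2 - P $ 2 * Q $ 1)\<^sup>2)"
    using P Q by algebra
  ultimately have "(P $ 1 - Q $ 1)\<^sup>2 + (P $ 2 - Q $ 2)\<^sup>2 + (P $ 1 * Q $ 2 - P $ 2 * Q $ 1)\<^sup>2 \<le> 0"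
    by linarith
  then have "(P $ 1 - Q $ 1)\<^sup>2 = 0" "(P $ 2 - Q $ 2)\<^sup>2 = 0"
    by (smt (verit) zero_le_power2)+
  then have 12: "P $ 1 = Q $ 1" "P $ 2 = Q $ 2"
    by simp_all
  then have "P $ 3 = Q $ 3"
    using P Q by (metis power2_eq_iff_nonneg less_imp_le)
  with 12 show False
    using \<open>P \<noteq> Q\<close> by (simp add: vec_eq_iff forall_3)
qed

lemma lorentz_le_minus_1:
  assumes "P \<in> H2" "Q \<in> H2"
  shows "lorentz P Q \<le> - 1"
  using lorentz_less_minus_1[OF assms] assms by (cases "P = Q") (auto simp: H2_def)

lemma hcircle_eq:
  assumes "c \<in> H2" "0 \<le> \<rho>"
  shows "hcircle c \<rho> = {x \<in> H2. lorentz c x = - 1 * cosh \<rho>}"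
proof -
  have "hdist c x = \<rho> \<longleftrightarrow> lorentz c x = - 1 * cosh \<rho>" if "x \<in> H2" for x
  proof
    assume "hdist c x = \<rho>"
    then have "cosh \<rho> = - lorentz c x"
      using lorentz_le_minus_1[OF assms(1) that] unfolding hdist_def by auto
    then show "lorentz c x = - 1 * cosh \<rho>"
      by simp
  qed (use assms in \<open>simp add: hdist_def arcosh_cosh_real\<close>)
  then show ?thesis
    unfolding hcircle_def by blast
qed

lemma hyperbolic_reflection:
  assumes "I \<in> H2" "p \<in> H2" "lorentz I p = - 1 * c" "0 < c"
  shows "(2 * c) *\<^sub>R I - p \<in> H2" "lorentz I ((2 * c) *\<^sub>R I - p) = - 1 * c"
proof -
  define q where "q = (2 * c) *\<^sub>R I - p"
  note lin = form_linear[where k = "- 1", unfolded form_lorentz]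
  have I: "lorentz I I = - 1" "lorentz p p = - 1" and pI: "lorentz p I = - c"
    using assms form_commute[of "- 1" p I] by (auto simp: H2_def form_lorentz)
  show Iq: "lorentz I ((2 * c) *\<^sub>R I - p) = - 1 * c"
    unfolding lin using assms(3) I by simp
  have qq: "lorentz q q = - 1"
    unfolding q_def lin using assms(3) I pI by (simp add: algebra_simps)
  have "0 < q $ 3"
  proof (rule ccontr)
    assume "\<not> 0 < q $ 3"
    moreover have "q $ 3 \<noteq> 0"
      using qq zero_le_square[of "q $ 1"] zero_le_square[of "q $ 2"]
      by (auto simp: lorentz_def simp del: zero_le_square)
    ultimately have "- q \<in> H2"
      using qq by (simp add: H2_def lorentz_def)
    from lorentz_le_minus_1[OF assms(1) this] have "lorentz I q \<ge> 1"
      by (simp add: lorentz_def)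
    then show False
      using Iq assms(4) by (simp add: q_def)
  qed
  with qq show "(2 * c) *\<^sub>R I - p \<in> H2"
    by (simp add: H2_def q_def)
qed

text \<open>The normal of the geodesic through two distinct vertices is spacelike; if the determinant
  vanishes, it is orthogonal to the third vertex as well.  If the three vertices coincide, any geodesic
  through that point will do.\<close>

lemma hyperbolic_triangle_triple_product:
  assumes "hyperbolic_triangle A B C"
  shows "A \<bullet> (B \<times> C) \<noteq> 0"
proof
  assume D: "A \<bullet> (B \<times> C) = 0"
  have H: "A \<in> H2" "B \<in> H2" "C \<in> H2"
    and no_geodesic: "\<And>n. 0 < lorentz n n \<Longrightarrow> {A, B, C} \<subseteq> hgeodesic n \<Longrightarrow> False"
    using assms unfolding hyperbolic_triangle_def by auto
  have spacelike: "0 < lorentz (conormal (- 1) P Q) (conormal (- 1) P Q)"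
    if "P \<in> H2" "Q \<in> H2" "P \<noteq> Q" for P Q
  proof -
    have "1 < (- lorentz P Q)\<^sup>2"
      using lorentz_less_minus_1[OF that] by (intro one_less_power) auto
    then show ?thesis
      using that hyperbolic.form_conormal_conormal[of P Q P Q] form_commute[of "- 1" Q P]
      by (simp add: form_lorentz H2_def power2_eq_square)
  qed
  have orth: "lorentz (conormal (- 1) P Q) v = v \<bullet> (P \<times> Q)" for P Q v
    using hyperbolic.form_conormal[of v P Q] form_commute[of "- 1" v] by (simp add: form_lorentz)
  consider "A \<noteq> B" | "A = B" "A \<noteq> C" | "A = B" "A = C"
    by blast
  then show False
  proof cases
    case 1
    then show False
      using no_geodesic[OF spacelike[OF H(1,2)]] H D
      by (auto simp: hgeodesic_def orth dot_cross_self) (simp add: triple_product algebra_simps)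
  next
    case 2
    then show False
      using no_geodesic[OF spacelike[OF H(1,3)]] H by (auto simp: hgeodesic_def orth dot_cross_self)
  next
    case 3
    define n :: "real^3" where "n = vector [A $ 3, 0, A $ 1]"
    have "lorentz n n = 1 + (A $ 2)\<^sup>2" "lorentz n A = 0"
      using H(1) by (simp_all add: n_def H2_def lorentz_def power2_eq_square)
    then show False
      using no_geodesic[of n] 3 H add_pos_nonneg[OF zero_less_one zero_le_power2[of "A $ 2"]]
      by (auto simp: hgeodesic_def)
  qed
qed

section \<open>Proper triangles\<close>

theorem hyperbolic_euler:
  assumes triangle: "hyperbolic_triangle A B C" and circum: "hyperbolic_circumscribed A B C Z R"
    and inscribed: "hyperbolic_inscribed A B C I r"
  shows "tanh (hdist Z I) =
    sqrt (tanh R * (tanh R - 2 * tanh r)) / sqrt (- (tanh r)\<^sup>2 + (1 - tanh r * tanh R)\<^sup>2)"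
proof -
  have H: "A \<in> H2" "B \<in> H2" "C \<in> H2" "Z \<in> H2" "I \<in> H2" and "0 < r"
    using assms by (auto simp: hyperbolic_triangle_def hyperbolic_circumscribed_def hyperbolic_inscribed_def)
  have D: "A \<bullet> (B \<times> C) \<noteq> 0"
    by (rule hyperbolic_triangle_triple_product) fact
  then have distinct: "A \<noteq> B" "B \<noteq> C" "C \<noteq> A"
    by (auto simp: dot_cross_self)
  note half_side = hyperbolic.half_side_exists[unfolded form_lorentz]
  obtain x X where x: "lorentz B C = - 1 - 2 * x\<^sup>2" "X\<^sup>2 = 1 - - 1 * x\<^sup>2" "0 < x" "0 < X"
    using lorentz_less_minus_1[OF H(2,3) distinct(2)] by (rule_tac half_side[of B C]) auto
  obtain y Y where y: "lorentz C A = - 1 - 2 * y\<^sup>2" "Y\<^sup>2 = 1 - - 1 * y\<^sup>2" "0 < y" "0 < Y"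
    using lorentz_less_minus_1[OF H(3,1) distinct(3)] by (rule_tac half_side[of C A]) auto
  obtain z W where z: "lorentz A B = - 1 - 2 * z\<^sup>2" "W\<^sup>2 = 1 - - 1 * z\<^sup>2" "0 < z" "0 < W"
    using lorentz_less_minus_1[OF H(1,2) distinct(1)] by (rule_tac half_side[of A B]) auto
  have S_pos: "0 < x * Y * W + X * y * W + X * Y * z - - 1 * x * y * z"
    using x y z by (simp add: add_pos_pos)
  have "hdist Z A = R"
    using circum by (auto simp: hyperbolic_circumscribed_def hcircle_def)
  then have "0 \<le> R"
    using lorentz_le_minus_1[OF H(4,1)] unfolding hdist_def by auto
  have on_circle: "lorentz Z A = - 1 * cosh R" "lorentz Z B = - 1 * cosh R" "lorentz Z C = - 1 * cosh R"
    using circum unfolding hyperbolic_circumscribed_def hcircle_eq[OF H(4) \<open>0 \<le> R\<close>] by auto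
  define K where "K = hcircle I r"
  have K: "K = {v \<in> H2. lorentz I v = - 1 * cosh r}"
    unfolding K_def using \<open>0 < r\<close> by (intro hcircle_eq H) simp
  have reflect: "(2 * cosh r) *\<^sub>R I - p \<in> K" if "p \<in> K" for p
    using that hyperbolic_reflection[OF H(5), of p "cosh r"] unfolding K by auto
  have tangent: "tangent_to_side H2 lorentz I K A B" "tangent_to_side H2 lorentz I K B C"
    "tangent_to_side H2 lorentz I K C A" and inside: "K \<subseteq> convex_cone hull {A, B, C}"
    using inscribed unfolding hyperbolic_inscribed_def geo_hull_def K_def by auto
  have "(lorentz Z I)\<^sup>2 = (cosh R * cosh r + - 1 * (sinh R * sinh r))\<^sup>2 + - 1 * (sinh r * cosh R)\<^sup>2"
  proof (rule hyperbolic.center_distance[unfolded form_lorentz, where M = H2 and K = K and A = A and B = B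
        and C = C and x = x and X = X and y = y and Y = Y and z = z and W = W and cR = "cosh R" and sR = "sinh R"])
    show "lorentz v v = - 1" if "v \<in> H2" for v
      using that by (simp add: H2_def)
  qed (fact H D on_circle K inside tangent S_pos | erule reflect | fact x y z
      | use x y z \<open>0 \<le> R\<close> \<open>0 < r\<close> in \<open>simp add: cosh_square_eq\<close>)+
  then show ?thesis
    unfolding hdist_def using lorentz_le_minus_1[OF H(4,5)] by (intro tanh_arcosh_euler) auto
qed

text \<open>Every point of the triangle has positive product with \<open>Z\<close>.  Applied to two opposite points of
  the inscribed circle, whose sum is \<open>2 * cos r * I\<close>, this shows both \<open>r < pi / 2\<close> and that \<open>Z\<close> and \<open>I\<close> are less than
  \<open>pi / 2\<close> apart.\<close>

theorem spherical_euler: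
  assumes S: "A \<in> S2" "B \<in> S2" "C \<in> S2"
    and distinct: "A \<noteq> B" "B \<noteq> C" "C \<noteq> A" "A \<noteq> - B" "B \<noteq> - C" "C \<noteq> - A"
    and D: "A \<bullet> (B \<times> C) \<noteq> 0" and circum: "spherical_circumscribed A B C Z R" and "R < pi / 2"
    and inscribed: "spherical_inscribed A B C (geo_hull S2 {A, B, C}) I r"
  shows "tan (sdist Z I) =
    sqrt (tan R * (tan R - 2 * tan r)) / sqrt ((tan r)\<^sup>2 + (1 + tan r * tan R)\<^sup>2)"
proof -
  have ZI: "Z \<in> S2" "I \<in> S2" and r: "0 < r" "r \<le> pi / 2"
    using circum inscribed by (auto simp: spherical_circumscribed_def spherical_inscribed_def)
  note half_side = spherical.half_side_exists[unfolded form_inner]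
  obtain x X where x: "B \<bullet> C = 1 - 2 * x\<^sup>2" "X\<^sup>2 = 1 - 1 * x\<^sup>2" "0 < x" "0 < X"
    using abs_inner_less_1[OF S(2,3) distinct(2,5)] by (rule_tac half_side[of B C]) auto
  obtain y Y where y: "C \<bullet> A = 1 - 2 * y\<^sup>2" "Y\<^sup>2 = 1 - 1 * y\<^sup>2" "0 < y" "0 < Y"
    using abs_inner_less_1[OF S(3,1) distinct(3,6)] by (rule_tac half_side[of C A]) auto
  obtain z W where z: "A \<bullet> B = 1 - 2 * z\<^sup>2" "W\<^sup>2 = 1 - 1 * z\<^sup>2" "0 < z" "0 < W"
    using abs_inner_less_1[OF S(1,2) distinct(1,4)] by (rule_tac half_side[of A B]) auto
  have gram: "(A \<bullet> (B \<times> C))\<^sup>2 = 1 + 2 * (1 - 2 * x\<^sup>2) * (1 - 2 * y\<^sup>2) * (1 - 2 * z\<^sup>2)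
       - (1 - 2 * x\<^sup>2)\<^sup>2 - (1 - 2 * y\<^sup>2)\<^sup>2 - (1 - 2 * z\<^sup>2)\<^sup>2"
    using spherical.gram_determinant[of A B C] unfolding form_inner x(1) y(1) z(1) inner_unit[OF S(1)]
      inner_unit[OF S(2)] inner_unit[OF S(3)] by algebra
  have S_pos: "0 < x * Y * W + X * y * W + X * Y * z - 1 * x * y * z"
    using sin_semiperimeter_pos[OF x(3) y(3) z(3) x(4) y(4) z(4) _ _ _ gram D] x(2) y(2) z(2) by simp
  note R = spherical_circumscribed_inner[OF S circum]
  have "0 < cos R" "0 \<le> sin R"
    using R(1) \<open>R < pi / 2\<close> by (auto intro!: cos_gt_zero_pi sin_ge_zero)
  have on_circle: "Z \<bullet> A = 1 * cos R" "Z \<bullet> B = 1 * cos R" "Z \<bullet> C = 1 * cos R"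
    using R by simp_all
  define K where "K = scircle I r"
  have K: "K = {v \<in> S2. I \<bullet> v = 1 * cos r}"
    unfolding K_def mult_1 using r ZI by (intro scircle_eq) auto
  have reflect: "(2 * cos r) *\<^sub>R I - p \<in> K" if "p \<in> K" for p
    using that spherical_reflection[OF ZI(2), of p "cos r"] unfolding K by auto
  have tangent: "tangent_to_side S2 (\<bullet>) I K A B" "tangent_to_side S2 (\<bullet>) I K B C"
    "tangent_to_side S2 (\<bullet>) I K C A" and inside: "K \<subseteq> convex_cone hull {A, B, C}"
    using inscribed unfolding spherical_inscribed_def geo_hull_def K_def by auto
  have Z_pos: "0 < Z \<bullet> v" if "v \<in> K" for v
  proof (rule hull_half_space_pos)
    show "v \<in> convex_cone hull {A, B, C}"
      using that inside by blast
    show "v \<noteq> 0"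
      using that K by auto
  qed (use on_circle \<open>0 < cos R\<close> in auto)
  obtain p where p: "p \<in> K"
    using tangent(1) unfolding tangent_to_side_def by auto
  have "0 < Z \<bullet> p + Z \<bullet> ((2 * cos r) *\<^sub>R I - p)"
    using Z_pos[OF p] Z_pos[OF reflect[OF p]] by simp
  then have *: "0 < cos r * (Z \<bullet> I)"
    by (simp add: inner_diff_right)
  moreover have "0 \<le> cos r"
    using r by (intro cos_ge_zero) auto
  ultimately have "0 < cos r" "0 < Z \<bullet> I"
    by (auto simp: zero_less_mult_iff)
  have "0 < sin r"
    using r by (intro sin_gt_zero) auto
  have "(Z \<bullet> I)\<^sup>2 = (cos R * cos r + 1 * (sin R * sin r))\<^sup>2 + 1 * (sin r * cos R)\<^sup>2"
  proof (rule spherical.center_distance[unfolded form_inner, where M = S2 and K = K and A = A and B = B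
        and C = C and x = x and X = X and y = y and Y = Y and z = z and W = W and cR = "cos R" and sR = "sin R"])
    show "v \<bullet> v = 1" if "v \<in> S2" for v
      using that by (rule inner_unit)
  qed (fact S ZI D on_circle K inside tangent S_pos \<open>0 < sin r\<close> \<open>0 < cos r\<close> \<open>0 \<le> sin R\<close>
      | erule reflect | fact x y z | use x y z \<open>0 < cos R\<close> in simp)+
  moreover have "\<bar>Z \<bullet> I\<bar> \<le> 1"
    using Cauchy_Schwarz_ineq2[of Z I] ZI by simp
  ultimately show ?thesis
    unfolding sdist_def using \<open>0 < cos r\<close> \<open>0 < Z \<bullet> I\<close> \<open>0 < cos R\<close>
    by (intro tan_arccos_euler) auto
qed

section \<open>The hemisphere as a triangle\<close>

lemma convex_cone_hull_pair:
  assumes "x \<in> convex_cone hull {P, Q}"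
  obtains a b where "0 \<le> a" "0 \<le> b" "x = a *\<^sub>R P + b *\<^sub>R Q"
proof -
  define S where "S = {a *\<^sub>R P + b *\<^sub>R Q | a b. 0 \<le> a \<and> 0 \<le> b}"
  have "convex_cone S"
    unfolding convex_cone_iff
  proof (intro conjI ballI allI impI)
    show "0 \<in> S"
      unfolding S_def by (auto intro!: exI[of _ 0])
    show "v + w \<in> S" if vw: "v \<in> S" "w \<in> S" for v w
    proof -
      obtain a b a' b' where "0 \<le> a" "0 \<le> b" "0 \<le> a'" "0 \<le> b'"
        "v = a *\<^sub>R P + b *\<^sub>R Q" "w = a' *\<^sub>R P + b' *\<^sub>R Q"
        using vw unfolding S_def by auto
      then have "v + w = (a + a') *\<^sub>R P + (b + b') *\<^sub>R Q" "0 \<le> a + a'" "0 \<le> b + b'"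
        by (auto simp: algebra_simps)
      then show ?thesis
        unfolding S_def by blast
    qed
    show "c *\<^sub>R v \<in> S" if v: "v \<in> S" "0 \<le> c" for v c
    proof -
      obtain a b where "0 \<le> a" "0 \<le> b" "v = a *\<^sub>R P + b *\<^sub>R Q"
        using v unfolding S_def by auto
      then have "c *\<^sub>R v = (c * a) *\<^sub>R P + (c * b) *\<^sub>R Q" "0 \<le> c * a" "0 \<le> c * b"
        using v by (auto simp: algebra_simps)
      then show ?thesis
        unfolding S_def by blast
    qed
  qed
  moreover have "P = 1 *\<^sub>R P + 0 *\<^sub>R Q" "Q = 0 *\<^sub>R P + 1 *\<^sub>R Q"
    by simp_all
  then have "P \<in> S" "Q \<in> S"
    unfolding S_def using zero_le_one zero_le_one order_refl by blast+
  ultimately have "convex_cone hull {P, Q} \<subseteq> S"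
    by (intro hull_minimal) auto
  then show ?thesis
    using assms that unfolding S_def by blast
qed

text \<open>A circle touching an arc of the great circle with pole \<open>n\<close> does so at a point proportional to the orthogonal
  projection of its centre to the plane of the great circle.  Unless \<open>cos r = 0\<close>, this point is
  therefore the same for all arcs of that great circle.\<close>

lemma great_circle_tangency:
  assumes n: "n \<in> S2" "n \<bullet> P = 0" "n \<bullet> Q = 0" and "I \<in> S2" "P \<times> Q \<noteq> 0" "0 \<le> r" "r \<le> pi"
    and tangent: "tangent_to_side S2 (\<bullet>) I (scircle I r) P Q"
  obtains p where "p \<in> S2" "p \<in> convex_cone hull {P, Q}" "cos r *\<^sub>R p = I - (n \<bullet> I) *\<^sub>R n" 
    "(n \<bullet> I)\<^sup>2 = (sin r)\<^sup>2"
proof -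
  obtain p where p: "p \<in> S2" "I \<bullet> p = cos r" "p \<in> convex_cone hull {P, Q}"
    and line: "circle_tangent_line (\<bullet>) I p = geodesic_tangent_line (\<bullet>) P Q p"
    using tangent assms(4,6,7) unfolding tangent_to_side_def geo_hull_def by (auto simp: scircle_eq)
  define l where "l = P \<bullet> (Q \<times> n)"
  have PQ: "P \<times> Q = l *\<^sub>R n"
    using spherical.dual_cramer[of P Q n n] n inner_unit[OF n(1)]
    by (simp add: form_inner l_def vec_eq_iff forall_3 cross3_def)
  then have "l \<noteq> 0"
    using assms(5) by auto
  have np: "n \<bullet> p = 0"
    using triple_product_span[OF p(3)] \<open>l \<noteq> 0\<close> unfolding PQ by (simp add: inner_commute)
  have "(I \<bullet> (P \<times> Q))\<^sup>2 = (sin r)\<^sup>2 * form 1 (conormal 1 P Q) (conormal 1 P Q)"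
    using p inner_unit assms(4) line triple_product_span[OF p(3)]
    by (intro spherical.tangent_triple_product[where c = "cos r"]) (auto simp: form_inner)
  moreover have "conormal 1 P Q = l *\<^sub>R n"
    unfolding PQ[symmetric] by (simp add: vec_eq_iff forall_3 cross3_def)
  ultimately have t: "(n \<bullet> I)\<^sup>2 = (sin r)\<^sup>2"
    using \<open>l \<noteq> 0\<close> inner_unit[OF n(1)] unfolding PQ
    by (simp add: form_inner power_mult_distrib inner_commute power2_eq_square)
  define w where "w = I - (n \<bullet> I) *\<^sub>R n - cos r *\<^sub>R p"
  have "p \<bullet> I = cos r" "p \<bullet> n = 0" "I \<bullet> n = n \<bullet> I"
    using p(2) np by (simp_all add: inner_commute)
  then have "w \<bullet> w = 1 - (cos r)\<^sup>2 - (n \<bullet> I)\<^sup>2"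
    unfolding w_def using inner_unit[OF n(1)] inner_unit[OF p(1)] inner_unit[OF assms(4)] p(2) np
    by (simp add: inner_diff_left inner_diff_right power2_eq_square)
  then have "w \<bullet> w = 0"
    using t sin_cos_squared_add[of r] by linarith
  then have "w = 0"
    by (simp only: inner_eq_zero_iff)
  then show ?thesis
    using p t by (intro that[of p]) (auto simp: w_def)
qed

text \<open>The three sides have no common point: \<open>- C\<close> lies on the side \<open>AB\<close>, so a point of \<open>BC\<close> or \<open>CA\<close> has,
  after eliminating \<open>C\<close>, a nonpositive coefficient of \<open>A\<close> or of \<open>B\<close> respectively, whereas a point of
  \<open>AB\<close> has nonnegative ones.  So the inscribed circle has radius \<open>pi / 2\<close> and its centre is \<open>Z\<close> or \<open>- Z\<close>.
  In both cases the tangent of the distance vanishes.\<close>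

theorem hemisphere_incenter:
  assumes S: "A \<in> S2" "B \<in> S2" "C \<in> S2"
    and distinct: "A \<noteq> B" "B \<noteq> C" "C \<noteq> A" "A \<noteq> - B" "B \<noteq> - C" "C \<noteq> - A"
    and Z: "Z \<in> S2" "Z \<bullet> A = 0" "Z \<bullet> B = 0" "Z \<bullet> C = 0"
    and cover: "geo_hull S2 {A, B} \<union> geo_hull S2 {B, C} \<union> geo_hull S2 {C, A} = great_circle n"
    and inscribed: "spherical_inscribed A B C T I r"
  shows "tan (sdist Z I) = 0"
proof -
  have I: "I \<in> S2" and r: "0 < r" "r \<le> pi / 2" "0 \<le> r" "r \<le> pi"
    using inscribed by (auto simp: spherical_inscribed_def)
  note tangency = great_circle_tangency[OF Z(1) _ _ I _ r(3,4)]
  obtain p where p: "p \<in> S2" "p \<in> convex_cone hull {A, B}" "cos r *\<^sub>R p = I - (Z \<bullet> I) *\<^sub>R Z"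
    and t: "(Z \<bullet> I)\<^sup>2 = (sin r)\<^sup>2"
    using inscribed cross_nonzero S distinct Z by (rule_tac tangency[of A B]) (auto simp: spherical_inscribed_def)
  obtain p' where p': "p' \<in> convex_cone hull {B, C}" "cos r *\<^sub>R p' = I - (Z \<bullet> I) *\<^sub>R Z"
    using inscribed cross_nonzero S distinct Z by (rule_tac tangency[of B C]) (auto simp: spherical_inscribed_def)
  obtain p'' where p'': "p'' \<in> convex_cone hull {C, A}" "cos r *\<^sub>R p'' = I - (Z \<bullet> I) *\<^sub>R Z"
    using inscribed cross_nonzero S distinct Z by (rule_tac tangency[of C A]) (auto simp: spherical_inscribed_def)
  have "cos r = 0"
  proof (rule ccontr)
    assume "cos r \<noteq> 0"
    then have eq: "p' = p" "p'' = p"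
      using p(3) p'(2) p''(2) by (auto intro: scaleR_left_imp_eq)
    have opposite: "- C \<notin> convex_cone hull {C, P}" if "P \<in> S2" "C \<noteq> - P" for P
    proof
      assume "- C \<in> convex_cone hull {C, P}"
      then obtain a b where ab: "0 \<le> a" "0 \<le> b" "- C = a *\<^sub>R C + b *\<^sub>R P"
        by (rule convex_cone_hull_pair)
      then have *: "(1 + a) *\<^sub>R C = - (b *\<^sub>R P)"
        unfolding eq_neg_iff_add_eq_0 scaleR_add_left scaleR_one add.assoc ab(3)[symmetric] by simp
      then have "norm ((1 + a) *\<^sub>R C) = norm (b *\<^sub>R P)"
        by simp
      then have "1 + a = b"
        using ab S that by simp
      then have "(1 + a) *\<^sub>R C = (1 + a) *\<^sub>R (- P)"
        using * by simp
      then show False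
        using ab(1) that(2) by (simp only: scaleR_cancel_left) simp
    qed
    have "C \<in> geo_hull S2 {B, C}"
      using S by (simp add: geo_hull_def hull_inc)
    then have "- C \<in> great_circle n"
      using cover by (auto simp: great_circle_def)
    moreover have "C \<noteq> - B"
      using distinct(5) by (metis minus_minus)
    ultimately have "- C \<in> convex_cone hull {A, B}"
      using opposite[of B] opposite[of A] S distinct unfolding cover[symmetric] geo_hull_def
      by (auto simp: insert_commute)
    then obtain a b where ab: "0 \<le> a" "0 \<le> b" "- C = a *\<^sub>R A + b *\<^sub>R B"
      by (rule convex_cone_hull_pair)
    obtain a1 b1 where 1: "0 \<le> a1" "0 \<le> b1" "p = a1 *\<^sub>R A + b1 *\<^sub>R B"
      using p(2) by (rule convex_cone_hull_pair)
    obtain b2 c2 where 2: "0 \<le> b2" "0 \<le> c2" "p = b2 *\<^sub>R B + c2 *\<^sub>R C"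
      using p'(1) unfolding eq by (rule convex_cone_hull_pair)
    obtain c3 a3 where 3: "0 \<le> c3" "0 \<le> a3" "p = c3 *\<^sub>R C + a3 *\<^sub>R A"
      using p''(1) unfolding eq by (rule convex_cone_hull_pair)
    have C: "C = (- a) *\<^sub>R A + (- b) *\<^sub>R B"
      using arg_cong[OF ab(3), of uminus] by simp
    have independent: "A \<times> B \<noteq> 0"
      using cross_nonzero S distinct by blast
    have "p \<times> B = a1 *\<^sub>R (A \<times> B)" "p \<times> B = (- (c2 * a)) *\<^sub>R (A \<times> B)"
      by (simp add: 1(3) cross_add_left cross_mult_left)
        (simp add: 2(3) C cross_add_left cross_mult_left del: scaleR_minus_left)
    then have "a1 = - (c2 * a)"
      using independent by (metis scaleR_right_imp_eq)
    moreover have "A \<times> p = b1 *\<^sub>R (A \<times> B)" "A \<times> p = (- (c3 * b)) *\<^sub>R (A \<times> B)"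
      by (simp add: 1(3) cross_add_right cross_mult_right)
        (simp add: 3(3) C cross_add_right cross_mult_right del: scaleR_minus_left)
    then have "b1 = - (c3 * b)"
      using independent by (metis scaleR_right_imp_eq)
    moreover have "0 \<le> c2 * a" "0 \<le> c3 * b"
      using ab 2 3 by simp_all
    ultimately have "a1 = 0" "b1 = 0"
      using 1 by linarith+
    then show False
      using p(1) 1 by simp
  qed
  then have "(Z \<bullet> I)\<^sup>2 = 1"
    using t sin_cos_squared_add[of r] by simp
  then have "Z \<bullet> I = 1 \<or> Z \<bullet> I = - 1"
    by (simp add: power2_eq_1_iff)
  then show ?thesis
    by (auto simp: sdist_def)
qed

section \<open>Euler's formula in both geometries\<close>

text \<open>On the sphere, the two kinds of triangle are separated by the circumradius: if \<open>R = pi / 2\<close>, the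
  vertices lie on the great circle with pole \<open>Z\<close>; if \<open>R < pi / 2\<close>, the sides lie in an open hemisphere about \<open>Z\<close>
  and cannot fill a great circle.\<close>

theorem theorem1p4:
  shows "(\<forall>(A::real^3) B C T Z I R r.
            spherical_triangle A B C T \<longrightarrow>
            spherical_circumscribed A B C Z R \<longrightarrow>
            spherical_inscribed A B C T I r \<longrightarrow>
            tan (sdist Z I) =
              (if R < pi / 2
               then sqrt (tan R * (tan R - 2 * tan r)) / sqrt ((tan r)\<^sup>2 + (1 + tan r * tan R)\<^sup>2)
               else 0)) \<and>
         (\<forall>(A::real^3) B C Z I R r.
            hyperbolic_triangle A B C \<longrightarrow>
            hyperbolic_circumscribed A B C Z R \<longrightarrow>
            hyperbolic_inscribed A B C I r \<longrightarrow>
            tanh (hdist Z I) =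
              sqrt (tanh R * (tanh R - 2 * tanh r)) / sqrt (- (tanh r)\<^sup>2 + (1 - tanh r * tanh R)\<^sup>2))"
proof (intro conjI allI impI)
  fix A B C :: "real^3" and T Z I R r
  assume triangle: "spherical_triangle A B C T" and circum: "spherical_circumscribed A B C Z R"
    and inscribed: "spherical_inscribed A B C T I r"
  have S: "A \<in> S2" "B \<in> S2" "C \<in> S2" and Z: "Z \<in> S2"
    and distinct: "A \<noteq> B" "B \<noteq> C" "C \<noteq> A" "A \<noteq> - B" "B \<noteq> - C" "C \<noteq> - A"
    using triangle circum unfolding spherical_triangle_def spherical_circumscribed_def by blast+
  note R = spherical_circumscribed_inner(1,2)[OF S circum]
    and on_circle = spherical_circumscribed_inner(3-5)[OF S circum]
  consider (proper) "\<not> (\<exists>n \<in> S2. {A, B, C} \<subseteq> great_circle n)" "T = geo_hull S2 {A, B, C}"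
    | (hemisphere) n where
      "geo_hull S2 {A, B} \<union> geo_hull S2 {B, C} \<union> geo_hull S2 {C, A} = great_circle n"
    using triangle unfolding spherical_triangle_def by blast
  then show "tan (sdist Z I) =
      (if R < pi / 2
       then sqrt (tan R * (tan R - 2 * tan r)) / sqrt ((tan r)\<^sup>2 + (1 + tan r * tan R)\<^sup>2)
       else 0)"
  proof cases
    case proper
    have "cos R \<noteq> 0"
      using proper(1) S Z on_circle by (auto simp: great_circle_def)
    then have "R \<noteq> pi / 2"
      using cos_pi_half by blast
    then have "R < pi / 2"
      using R by simp
    moreover have "A \<bullet> (B \<times> C) \<noteq> 0"
      using proper(1) great_circle_coplanar[OF S distinct(1,4)] by blast
    ultimately show ?thesis
      using spherical_euler[OF S distinct _ circum _ inscribed[unfolded proper(2)]] by simp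
  next
    case hemisphere
    have "\<not> R < pi / 2"
    proof
      assume "R < pi / 2"
      then have "0 < cos R"
        using R by (intro cos_gt_zero_pi) auto
      have "A \<in> geo_hull S2 {A, B}"
        using S by (simp add: geo_hull_def hull_inc)
      then have "- A \<in> great_circle n"
        using hemisphere by (auto simp: great_circle_def)
      moreover have "convex_cone hull {A, B} \<subseteq> convex_cone hull {A, B, C}"
        "convex_cone hull {B, C} \<subseteq> convex_cone hull {A, B, C}"
        "convex_cone hull {C, A} \<subseteq> convex_cone hull {A, B, C}"
        by (intro hull_mono; auto)+
      ultimately have "- A \<in> convex_cone hull {A, B, C}"
        unfolding hemisphere[symmetric] geo_hull_def by auto
      then have "0 < Z \<bullet> (- A)"
        by (rule hull_half_space_pos) (use S on_circle \<open>0 < cos R\<close> in auto)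
      then show False
        using on_circle \<open>0 < cos R\<close> by simp
    qed
    then have "R = pi / 2"
      using R by simp
    then have "cos R = 0"
      by (simp only: cos_pi_half)
    then show ?thesis
      using hemisphere_incenter[OF S distinct Z _ _ _ hemisphere inscribed] on_circle \<open>\<not> R < pi / 2\<close> by simp
  qed
qed (rule hyperbolic_euler)

end
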